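(* Let $n\ge 1$ be an integer, let $h=\frac{1}{n+1}$, and let $A\in\mathbb{R}^{n\times n}$ be the tridiagonal matrix with entries $A_{ii}=\frac{2}{h^2}$ for $1\le i\le n$, $A_{i,i+1}=A_{i+1,i}=-\frac{1}{h^2}$ for $1\le i\le n-1$, and all other entries equal to $0$. Then $A$ is invertible and, for all $i,k\in\{1,\ldots,n\}$, $$(A^{-1})_{ik} = h^2\left(\frac{n+1-k}{n+1}\, i-(i-k)_+\right)=\frac{h^2}{2(n+1)}\sum_{j=1}^{n}\frac{\sin(j\pi k h)}{\sin^2\left(\frac{j\pi h}{2}\right)}\,\sin(j\pi i h).$$
   Context: For a real number $t$, $(t)_+=\max(t,0)$ denotes the positive part. The matrix $A$ is the finite difference discretization of $-u''$ on $(0,1)$ with homogeneous Dirichlet boundary conditions $u(0)=u(1)=0$ on the uniform mesh $x_j=jh$, with $n$ interior unknowns and $(n+1)h=1$. *)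

theory Defs
  imports Complex_Main "Jordan_Normal_Form.Gauss_Jordan_Elimination"
begin

(* Matrix indices in Jordan_Normal_Form start at 0: the mathematical entry (i,k), with
   1 \<le> i,k \<le> n, is accessed as $$ (i - 1, k - 1). *)
definition dirichlet_mat :: "nat \<Rightarrow> real \<Rightarrow> real mat" where
  "dirichlet_mat n h = mat n n (\<lambda>(i, j).
     if i = j then 2 / h\<^sup>2
     else if j = i + 1 \<or> i = j + 1 then - (1 / h\<^sup>2)
     else 0)"

end

theory Submission
  imports Defs "Jordan_Normal_Form.Determinant"
begin

text \<open>Both expressions for \<open>(A\<^sup>-\<^sup>1)\<^sub>i\<^sub>k\<close>, divided by \<open>h\<^sup>2\<close> and read as functions of \<open>i \<in> {0..n+1}\<close>,
  vanish at \<open>0\<close> and at \<open>n + 1\<close> and have negative second difference \<open>\<delta>\<^sub>i\<^sub>k\<close>. For the closed form this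
  is immediate; for the trigonometric sum, each \<open>sin (j \<pi> i h)\<close> is an eigenfunction with eigenvalue
  \<open>4 sin\<^sup>2 (j \<pi> h / 2)\<close>, which cancels the denominator, and discrete orthogonality of the sines remains.
  A function with vanishing second differences and zero boundary values is zero, so the two agree.\<close>

text \<open>The discrete Green function with source at node \<open>k\<close>, mesh width scaled out;
  the arguments \<open>0\<close> and \<open>n + 1\<close> are the boundary nodes.\<close>

definition green :: "nat \<Rightarrow> nat \<Rightarrow> nat \<Rightarrow> real" where
  "green n k i = (real n + 1 - real k) / (real n + 1) * real i - max (real i - real k) 0"

definition sine_sum :: "nat \<Rightarrow> nat \<Rightarrow> nat \<Rightarrow> real" where
  "sine_sum n k i = (\<Sum>j = 1..n. sin (real j * pi * real k / (real n + 1)) /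
     (sin (real j * pi / (real n + 1) / 2))\<^sup>2 * sin (real j * pi * real i / (real n + 1)))"

section \<open>Uniqueness for the discrete boundary value problem\<close>

lemma second_difference_zero_imp_zero:
  fixes f :: "nat \<Rightarrow> real"
  assumes "f 0 = 0" and "f (Suc n) = 0"
    and "\<And>i. i < n \<Longrightarrow> 2 * f (Suc i) - f i - f (Suc (Suc i)) = 0"
    and "i \<le> Suc n"
  shows "f i = 0"
proof -
  \<comment> \<open>Two consecutive values are carried because the recurrence has order two;
    \<open>i \<le> n\<close> then reaches \<open>Suc n\<close>, where the second zero kills the
    slope \<open>f 1\<close>.\<close>
  have linear: "f i = real i * f 1 \<and> f (Suc i) = real (Suc i) * f 1" if "i \<le> n" for i
    using that
  proof (induction i)
    case 0
    then show ?case using assms(1) by simp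
  next
    case (Suc i)
    then have "f i = real i * f 1" "f (Suc i) = real (Suc i) * f 1" by auto
    with assms(3)[of i] Suc.prems show ?case by (simp add: algebra_simps)
  qed
  from linear[of n] assms(2) have "f 1 = 0" by auto
  with linear[of "i - 1"] assms(1,4) show ?thesis by (cases i) auto
qed

section \<open>The closed form\<close>

lemma green_0: "green n k 0 = 0"
  by (simp add: green_def)

lemma green_end: "k \<le> Suc n \<Longrightarrow> green n k (Suc n) = 0"
  by (simp add: green_def field_simps)

text \<open>The linear term drops out, and the kink of the positive part at \<open>k\<close>
  contributes the 1.\<close>

lemma green_second_difference:
  "2 * green n k (Suc i) - green n k i - green n k (Suc (Suc i)) = (if Suc i = k then 1 else 0)"
proof -
  have "2 * max (real (Suc i) - real k) 0 - max (real i - real k) 0 - max (real (Suc (Suc i)) - real k) 0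
    = - (if Suc i = k then 1 else 0)"
    by (auto simp: max_def)
  moreover define c where "c = (real n + 1 - real k) / (real n + 1)"
  have "2 * (c * real (Suc i)) - c * real i - c * real (Suc (Suc i)) = 0"
    by (simp add: algebra_simps)
  ultimately show ?thesis
    unfolding green_def c_def[symmetric] by (simp only: right_diff_distrib)
qed

section \<open>Cosine sums and orthogonality of the grid sines\<close>

text \<open>Telescoping: \<open>2 * sin (x / 2) * cos (j * x)\<close> is the difference of the sines
  of \<open>(j + 1/2) * x\<close> and \<open>(j - 1/2) * x\<close>. The last angle is written around
  \<open>(n + 1) * x\<close>, a multiple of pi in the application.\<close>

lemma sum_cos_multiples:
  fixes x :: real
  shows "2 * sin (x / 2) * (\<Sum>j = 1..n. cos (real j * x)) = sin ((real n + 1) * x - x / 2) - sin (x / 2)"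
proof (induction n)
  case 0
  show ?case by simp
next
  case (Suc n)
  define y where "y = (real n + 1) * x"
  have "sin (y + x - x / 2) = sin (y + x / 2)" by (simp add: field_simps)
  then have "sin (y + x - x / 2) - sin (y - x / 2) = 2 * sin (x / 2) * cos y"
    by (simp add: sin_add sin_diff)
  with Suc show ?case by (simp add: y_def algebra_simps)
qed

text \<open>The first sine reduces to \<open>- cos ((n + 1) * x) * sin (x / 2)\<close>, so
  \<open>sin (x / 2)\<close> cancels. The cosine, in fact a sign, stays unevaluated to avoid parity
  cases.\<close>

lemma sum_cos_multiples_grid:
  fixes x :: real
  assumes "sin ((real n + 1) * x) = 0" and "sin (x / 2) \<noteq> 0"
  shows "(\<Sum>j = 1..n. cos (real j * x)) = - (1 + cos ((real n + 1) * x)) / 2"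
proof -
  have "2 * sin (x / 2) * (\<Sum>j = 1..n. cos (real j * x))
    = 2 * sin (x / 2) * (- (1 + cos ((real n + 1) * x)) / 2)"
    unfolding sum_cos_multiples sin_diff assms(1) by (simp add: algebra_simps)
  with assms(2) show ?thesis by simp
qed

text \<open>The angle lies strictly between -pi and pi, where sine vanishes only at 0. Negative
  \<open>a\<close> occurs as a difference of node indices.\<close>

lemma sin_half_grid_nonzero:
  fixes a :: real
  assumes "a \<noteq> 0" and "\<bar>a\<bar> < 2 * (real n + 1)"
  shows "sin (a * pi / (real n + 1) / 2) \<noteq> 0"
proof
  define b where "b = a / (2 * (real n + 1))"
  have "\<bar>b\<bar> < 1" using assms(2) unfolding b_def by (simp add: abs_divide)
  then have "-1 < b" "b < 1" by (simp_all add: abs_less_iff)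
  then have "- pi < b * pi" "b * pi < pi"
    using mult_strict_right_mono[OF \<open>-1 < b\<close> pi_gt_zero] by simp_all
  moreover assume "sin (a * pi / (real n + 1) / 2) = 0"
  moreover have "a * pi / (real n + 1) / 2 = b * pi" by (simp add: b_def field_simps)
  ultimately have "b * pi = 0" using sin_eq_0_pi by metis
  with assms(1) show False by (simp add: b_def add_nonneg_eq_0_iff)
qed

text \<open>Product-to-sum gives half the difference of two cosine sums, with angles from
  \<open>i - k\<close> and \<open>i + k\<close>. These sums coincide for
  \<open>i \<noteq> k\<close>; otherwise they are \<open>n\<close> and -1.\<close>

lemma sines_orthogonal:
  assumes "i \<in> {1..n}" and "k \<in> {1..n}"
  shows "(\<Sum>j = 1..n. sin (real j * pi * real k / (real n + 1)) * sin (real j * pi * real i / (real n + 1)))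
    = (if i = k then (real n + 1) / 2 else 0)"
proof -
  define N where "N = real n + 1"
  have N: "N > 0" by (simp add: N_def)
  define x where "x = (real i - real k) * pi / N"
  define y where "y = (real i + real k) * pi / N"
  have Nx: "N * x = real i * pi - real k * pi" and Ny: "N * y = real i * pi + real k * pi"
    using N by (simp_all add: x_def y_def left_diff_distrib distrib_right)
  have "sin (real j * pi * real k / N) * sin (real j * pi * real i / N)
      = (cos (real j * x) - cos (real j * y)) / 2" for j
  proof -
    have "real j * x = real j * pi * real i / N - real j * pi * real k / N"
      "real j * y = real j * pi * real i / N + real j * pi * real k / N"
      by (simp_all add: x_def y_def diff_divide_distrib add_divide_distrib algebra_simps)
    then show ?thesis by (simp add: cos_diff cos_add)
  qed
  then have "(\<Sum>j = 1..n. sin (real j * pi * real k / N) * sin (real j * pi * real i / N))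
      = ((\<Sum>j = 1..n. cos (real j * x)) - (\<Sum>j = 1..n. cos (real j * y))) / 2"
    by (simp only: sum_subtractf sum_divide_distrib[symmetric])
  moreover have "(\<Sum>j = 1..n. cos (real j * y)) = - (1 + cos (N * y)) / 2"
    unfolding N_def
  proof (rule sum_cos_multiples_grid)
    show "sin ((real n + 1) * y) = 0" using Ny by (simp add: N_def sin_add)
    show "sin (y / 2) \<noteq> 0"
      unfolding y_def N_def by (rule sin_half_grid_nonzero) (use assms in auto)
  qed
  moreover have "(\<Sum>j = 1..n. cos (real j * x)) = - (1 + cos (N * x)) / 2" if "i \<noteq> k"
    unfolding N_def
  proof (rule sum_cos_multiples_grid)
    show "sin ((real n + 1) * x) = 0" using Nx by (simp add: N_def sin_diff)
    show "sin (x / 2) \<noteq> 0"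
      unfolding x_def N_def by (rule sin_half_grid_nonzero) (use assms that in auto)
  qed
  \<comment> \<open>The two angles differ by \<open>2 * k * pi\<close>.\<close>
  moreover have "cos (N * x) = cos (N * y)"
    using Nx Ny by (simp add: cos_diff cos_add)
  moreover have "(\<Sum>j = 1..n. cos (real j * x)) = real n" "cos (N * x) = 1" if "i = k"
    using that by (simp_all add: x_def)
  ultimately show ?thesis
    unfolding N_def by (auto simp: field_simps)
qed

section \<open>The trigonometric sum\<close>

lemma sine_sum_0: "sine_sum n k 0 = 0"
  by (simp add: sine_sum_def)

lemma sine_sum_end: "sine_sum n k (Suc n) = 0"
proof -
  have "sin (real j * pi * real (Suc n) / (real n + 1)) = 0" for j
  proof -
    have "real j * pi * real (Suc n) / (real n + 1) = real j * pi" by (simp add: field_simps)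
    then show ?thesis by (metis sin_npi)
  qed
  then show ?thesis by (simp only: sine_sum_def mult_zero_right sum.neutral_const)
qed

text \<open>The outer sines add up to \<open>2 * sin a * cos x\<close>, and
  \<open>2 - 2 * cos x\<close> is the eigenvalue.\<close>

lemma sin_second_difference:
  fixes a x :: real
  shows "2 * sin a - sin (a - x) - sin (a + x) = 4 * (sin (x / 2))\<^sup>2 * sin a"
proof -
  have "cos x = 1 - 2 * (sin (x / 2))\<^sup>2"
    using cos_double_sin[of "x / 2"] by simp
  then show ?thesis unfolding sin_add sin_diff by (simp only:) (simp add: algebra_simps)
qed

lemma sine_sum_second_difference:
  assumes "i < n" and "k \<in> {1..n}"
  shows "2 * sine_sum n k (Suc i) - sine_sum n k i - sine_sum n k (Suc (Suc i))
    = (if Suc i = k then 2 * (real n + 1) else 0)"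
proof -
  define N where "N = real n + 1"
  have N: "N > 0" by (simp add: N_def)
  define s where "s j l = sin (real j * pi * real l / N)" for j l
  define d where "d j = (sin (real j * pi / N / 2))\<^sup>2" for j :: nat
  \<comment> \<open>\<open>j\<close> lies strictly between 0 and \<open>2 * (n + 1)\<close>, so no
    denominator vanishes and the eigenvalue can cancel it.\<close>
  have d: "d j \<noteq> 0" if "j \<in> {1..n}" for j
    using sin_half_grid_nonzero[of "real j" n] that by (simp add: d_def N_def)
  have sd: "2 * s j (Suc i) - s j i - s j (Suc (Suc i)) = 4 * d j * s j (Suc i)" for j
  proof -
    have "real j * pi * real i / N = real j * pi * real (Suc i) / N - real j * pi / N"
      "real j * pi * real (Suc (Suc i)) / N = real j * pi * real (Suc i) / N + real j * pi / N"
      by (simp_all add: diff_divide_distrib[symmetric] add_divide_distrib[symmetric] algebra_simps)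
    then show ?thesis
      unfolding s_def d_def using sin_second_difference by presburger
  qed
  have S: "sine_sum n k l = (\<Sum>j = 1..n. s j k / d j * s j l)" for l
    by (simp add: sine_sum_def s_def d_def N_def)
  have "2 * sine_sum n k (Suc i) - sine_sum n k i - sine_sum n k (Suc (Suc i))
      = (\<Sum>j = 1..n. s j k / d j * (2 * s j (Suc i) - s j i - s j (Suc (Suc i))))"
    by (simp add: S sum_subtractf sum_distrib_left right_diff_distrib mult_ac)
  also have "\<dots> = (\<Sum>j = 1..n. 4 * (s j k * s j (Suc i)))"
    by (rule sum.cong) (simp_all add: sd d)
  also have "\<dots> = 4 * (\<Sum>j = 1..n. s j k * s j (Suc i))"
    by (simp add: sum_distrib_left)
  also have "\<dots> = (if Suc i = k then 2 * (real n + 1) else 0)"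
    using sines_orthogonal[of "Suc i" n k] assms by (simp add: s_def N_def)
  finally show ?thesis .
qed

lemma green_eq_sine_sum:
  assumes "i \<le> Suc n" and "k \<in> {1..n}"
  shows "green n k i = sine_sum n k i / (2 * (real n + 1))"
proof -
  define c where "c = 2 * (real n + 1)"
  have c: "c > 0" by (simp add: c_def)
  \<comment> \<open>Scaling by \<open>c\<close> matches the sources 1 and \<open>2 * (n + 1)\<close>
    at node \<open>k\<close>, so they cancel in \<open>f\<close>.\<close>
  define f where "f l = c * green n k l - sine_sum n k l" for l
  have "f i = 0"
  proof (rule second_difference_zero_imp_zero[OF _ _ _ assms(1)])
    show "f 0 = 0" by (simp add: f_def green_0 sine_sum_0)
    show "f (Suc n) = 0" using assms(2) by (simp add: f_def green_end sine_sum_end)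
    fix l assume "l < n"
    have "2 * f (Suc l) - f l - f (Suc (Suc l))
      = c * (2 * green n k (Suc l) - green n k l - green n k (Suc (Suc l)))
        - (2 * sine_sum n k (Suc l) - sine_sum n k l - sine_sum n k (Suc (Suc l)))"
      by (simp add: f_def algebra_simps)
    also have "\<dots> = 0"
      unfolding green_second_difference sine_sum_second_difference[OF \<open>l < n\<close> assms(2)]
      by (simp add: c_def)
    finally show "2 * f (Suc l) - f l - f (Suc (Suc l)) = 0" .
  qed
  then have "green n k i = sine_sum n k i / c" using c by (simp add: f_def field_simps)
  then show ?thesis by (simp only: c_def)
qed

section \<open>The matrix and its inverse\<close>

text \<open>Column \<open>l\<close> belongs to node \<open>Suc l\<close>. The first and last rows
  lack a neighbour entry, and the zero boundary values make up for it.\<close>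

lemma dirichlet_mat_row_sum:
  fixes f :: "nat \<Rightarrow> real"
  assumes "f 0 = 0" and "f (Suc n) = 0" and "i < n"
  shows "(\<Sum>l = 0..<n. dirichlet_mat n h $$ (i, l) * f (Suc l))
    = (2 * f (Suc i) - f i - f (Suc (Suc i))) / h\<^sup>2"
proof -
  have "(\<Sum>l = 0..<n. dirichlet_mat n h $$ (i, l) * f (Suc l))
    = (\<Sum>l = 0..<n. (if l = i then 2 / h\<^sup>2 * f (Suc i) else 0)
        - (if l = Suc i then f (Suc (Suc i)) / h\<^sup>2 else 0)
        - (if Suc l = i then f i / h\<^sup>2 else 0))"
    using assms(3) by (intro sum.cong) (auto simp: dirichlet_mat_def)
  also have "\<dots> = 2 / h\<^sup>2 * f (Suc i) - f (Suc (Suc i)) / h\<^sup>2 - f i / h\<^sup>2"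
  proof -
    have "(\<Sum>l = 0..<n. if l = Suc i then f (Suc (Suc i)) / h\<^sup>2 else 0) = f (Suc (Suc i)) / h\<^sup>2"
      using assms(2,3) by (cases "Suc i = n") (auto simp: sum.delta)
    moreover have "(\<Sum>l = 0..<n. if Suc l = i then f i / h\<^sup>2 else 0) = f i / h\<^sup>2"
      using assms(1,3) by (cases i) (auto simp: sum.delta)
    ultimately show ?thesis
      using assms(3) by (simp add: sum_subtractf sum.delta)
  qed
  finally show ?thesis by (simp add: diff_divide_distrib)
qed

definition green_mat :: "nat \<Rightarrow> real \<Rightarrow> real mat" where
  "green_mat n h = mat n n (\<lambda>(i, k). h\<^sup>2 * green n (Suc k) (Suc i))"

text \<open>The matrix acts on each column as a second difference over \<open>h\<^sup>2\<close>;
  this factor cancels and the unit source remains.\<close>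

lemma dirichlet_mat_mult_green_mat:
  assumes "h \<noteq> 0"
  shows "dirichlet_mat n h * green_mat n h = 1\<^sub>m n"
proof (rule eq_matI)
  fix i k assume "i < dim_row (1\<^sub>m n :: real mat)" and "k < dim_col (1\<^sub>m n :: real mat)"
  then have ik: "i < n" "k < n" by auto
  have "(dirichlet_mat n h * green_mat n h) $$ (i, k)
    = (\<Sum>l = 0..<n. dirichlet_mat n h $$ (i, l) * (h\<^sup>2 * green n (Suc k) (Suc l)))"
    using ik by (simp add: scalar_prod_def green_mat_def dirichlet_mat_def)
  also have "\<dots> = (2 * (h\<^sup>2 * green n (Suc k) (Suc i)) - h\<^sup>2 * green n (Suc k) i
      - h\<^sup>2 * green n (Suc k) (Suc (Suc i))) / h\<^sup>2"
    using ik by (intro dirichlet_mat_row_sum) (simp_all add: green_0 green_end)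
  also have "\<dots> = 2 * green n (Suc k) (Suc i) - green n (Suc k) i - green n (Suc k) (Suc (Suc i))"
    using assms by (simp add: field_simps)
  finally show "(dirichlet_mat n h * green_mat n h) $$ (i, k) = 1\<^sub>m n $$ (i, k)"
    using ik by (simp add: green_second_difference)
qed (simp_all add: dirichlet_mat_def green_mat_def)

text \<open>For square matrices over a field a right inverse is two-sided, and a two-sided inverse
  is unique.\<close>

lemma mat_inverse_eqI:
  fixes A :: "'a :: field mat"
  assumes A: "A \<in> carrier_mat n n" and B: "B \<in> carrier_mat n n" and AB: "A * B = 1\<^sub>m n"
  shows "mat_inverse A = Some B"
proof -
  have BA: "B * A = 1\<^sub>m n"
    using mat_mult_left_right_inverse[OF A B AB] .
  show ?thesis
  proof (cases "mat_inverse A")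
    case None
    \<comment> \<open>\<open>None\<close> would say that \<open>A\<close> is no unit of the matrix
      ring, but \<open>B\<close> makes it one.\<close>
    with mat_inverse(1)[OF A None, of "()"] A B AB BA show ?thesis
      by (auto simp: Units_def ring_mat_def)
  next
    case (Some C)
    then have C: "C \<in> carrier_mat n n" and CA: "C * A = 1\<^sub>m n"
      using mat_inverse(2)[OF A] by auto
    have "C = C * (A * B)" using C AB by simp
    also have "\<dots> = C * A * B" using A B C by (simp add: assoc_mult_mat)
    also have "\<dots> = B" using B CA by simp
    finally show ?thesis using Some by simp
  qed
qed

theorem theorem2:
  fixes n :: nat and h :: real and A :: "real mat"
  assumes "n \<ge> 1"
    and "h = 1 / (real n + 1)"
    and "A = dirichlet_mat n h"
  shows "invertible_mat A \<and>
    (\<exists>B \<in> carrier_mat n n. mat_inverse A = Some B \<and>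
      (\<forall>i \<in> {1..n}. \<forall>k \<in> {1..n}.
        B $$ (i - 1, k - 1) =
          h\<^sup>2 * ((real n + 1 - real k) / (real n + 1) * real i - max (real i - real k) 0) \<and>
        h\<^sup>2 * ((real n + 1 - real k) / (real n + 1) * real i - max (real i - real k) 0) =
          h\<^sup>2 / (2 * (real n + 1)) *
            (\<Sum>j = 1..n. sin (real j * pi * real k * h) / (sin (real j * pi * h / 2))\<^sup>2
                          * sin (real j * pi * real i * h))))"
proof -
  have h: "h \<noteq> 0" using assms(2) by simp
  have A: "A \<in> carrier_mat n n" by (simp add: assms(3) dirichlet_mat_def)
  have G: "green_mat n h \<in> carrier_mat n n" by (simp add: green_mat_def)
  have AG: "A * green_mat n h = 1\<^sub>m n"
    unfolding assms(3) by (rule dirichlet_mat_mult_green_mat[OF h])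
  have GA: "green_mat n h * A = 1\<^sub>m n"
    using mat_mult_left_right_inverse[OF A G AG] .
  have "invertible_mat A"
    unfolding invertible_mat_def inverts_mat_def using A G AG GA by auto
  moreover have "mat_inverse A = Some (green_mat n h)"
    using A G AG by (rule mat_inverse_eqI)
  moreover have "green_mat n h $$ (i - 1, k - 1) =
          h\<^sup>2 * ((real n + 1 - real k) / (real n + 1) * real i - max (real i - real k) 0)"
    if "i \<in> {1..n}" "k \<in> {1..n}" for i k
    using that by (auto simp: green_mat_def green_def)
  moreover have "h\<^sup>2 * ((real n + 1 - real k) / (real n + 1) * real i - max (real i - real k) 0) =
          h\<^sup>2 / (2 * (real n + 1)) *
            (\<Sum>j = 1..n. sin (real j * pi * real k * h) / (sin (real j * pi * h / 2))\<^sup>2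
                          * sin (real j * pi * real i * h))"
    if "i \<in> {1..n}" "k \<in> {1..n}" for i k
    \<comment> \<open>With the value of \<open>h\<close> inserted, this is the comparison of
      \<open>green\<close> and \<open>sine_sum\<close> times \<open>h\<^sup>2\<close>.\<close>
    using green_eq_sine_sum[of i n k] that by (simp add: green_def sine_sum_def assms(2))
  ultimately show ?thesis using G by blast
qed

end
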